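(* Let $p,q$ be positive integers, let $n=pq$, and let $1\le r\le n$, $1\le s\le n$ with $p\mid r$ and $q\mid s$. Then any $r\times s$ $(p,q)$-Sudoku rectangle $R$ on the symbols $\{1,\dots,n\}$ can be extended to an $n\times n$ $(p,q)$-Sudoku square on the symbols $\{1,\dots,n\}$; that is, there is an $n\times n$ $(p,q)$-Sudoku square whose top left-hand $r\times s$ subarray (first $r$ rows, first $s$ columns) is $R$.
   Context: A latin square of order $n$ is an $n\times n$ array with entries from $\{1,\dots,n\}$ in which each symbol occurs exactly once in each row and each column. An $r\times s$ latin rectangle on the symbols $\{1,\dots,n\}$ is an $r\times s$ array in which every cell is filled with a symbol from $\{1,\dots,n\}$ and no symbol occurs more than once in any row or column. For $n=pq$, the big cells of the $n\times n$ grid are the $p\times q$ rectangles $\{(xp+i,\,yq+j): 1\le i\le p,\ 1\le j\le q\}$ for $0\le x\le q-1$, $0\le y\le p-1$. A $(p,q)$-Sudoku square is a latin square of order $n=pq$ in which each big cell contains each of the symbols $1,\dots,n$ exactly once. An $r\times s$ $(p,q)$-Sudoku rectangle on $n=pq$ symbols ($r,s\le n$) is an $r\times s$ latin rectangle on $\{1,\dots,n\}$, regarded as occupying the first $r$ rows and first $s$ columns of the $n\times n$ grid, such that no symbol occurs more than once within the part of any big cell that lies in the rectangle. (When $p\mid r$ and $q\mid s$ the rectangle is a union of full $p\times q$ big cells, each of which then contains each symbol exactly once.) *)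

theory Defs
  imports Main
begin

(* Arrays are functions A :: nat => nat => nat with A i j the entry in row i and column j.
   Rows, columns and symbols are all numbered from 1; values of A outside the index range of the
   array in question are irrelevant and never constrained. *)

definition latin_square :: "nat \<Rightarrow> (nat \<Rightarrow> nat \<Rightarrow> nat) \<Rightarrow> bool" where
  "latin_square n L \<longleftrightarrow>
     (\<forall>i\<in>{1..n}. \<forall>j\<in>{1..n}. L i j \<in> {1..n}) \<and>
     (\<forall>i\<in>{1..n}. \<forall>k\<in>{1..n}. \<exists>!j. j \<in> {1..n} \<and> L i j = k) \<and>
     (\<forall>j\<in>{1..n}. \<forall>k\<in>{1..n}. \<exists>!i. i \<in> {1..n} \<and> L i j = k)"

definition latin_rectangle :: "nat \<Rightarrow> nat \<Rightarrow> nat \<Rightarrow> (nat \<Rightarrow> nat \<Rightarrow> nat) \<Rightarrow> bool" where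
  "latin_rectangle r s n R \<longleftrightarrow>
     (\<forall>i\<in>{1..r}. \<forall>j\<in>{1..s}. R i j \<in> {1..n}) \<and>
     (\<forall>i\<in>{1..r}. inj_on (\<lambda>j. R i j) {1..s}) \<and>
     (\<forall>j\<in>{1..s}. inj_on (\<lambda>i. R i j) {1..r})"

(* The big cells of the grid of order p * q are those with x < q and y < p:
   a big cell has p rows and q columns, so there are q bands of rows and p bands of columns. *)
definition big_cell :: "nat \<Rightarrow> nat \<Rightarrow> nat \<Rightarrow> nat \<Rightarrow> (nat \<times> nat) set" where
  "big_cell p q x y = {(x * p + i, y * q + j) |i j. i \<in> {1..p} \<and> j \<in> {1..q}}"

definition sudoku_square :: "nat \<Rightarrow> nat \<Rightarrow> (nat \<Rightarrow> nat \<Rightarrow> nat) \<Rightarrow> bool" where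
  "sudoku_square p q L \<longleftrightarrow>
     latin_square (p * q) L \<and>
     (\<forall>x<q. \<forall>y<p. \<forall>k\<in>{1..p * q}. \<exists>!c. c \<in> big_cell p q x y \<and> L (fst c) (snd c) = k)"

definition sudoku_rectangle ::
    "nat \<Rightarrow> nat \<Rightarrow> nat \<Rightarrow> nat \<Rightarrow> (nat \<Rightarrow> nat \<Rightarrow> nat) \<Rightarrow> bool" where
  "sudoku_rectangle p q r s R \<longleftrightarrow>
     r \<le> p * q \<and> s \<le> p * q \<and>
     latin_rectangle r s (p * q) R \<and>
     (\<forall>x<q. \<forall>y<p. inj_on (\<lambda>c. R (fst c) (snd c)) (big_cell p q x y \<inter> {1..r} \<times> {1..s}))"

end

theory Submission
  imports Defs
begin

text \<open>
  The problem reduces to adding columns. A rectangle on all \<open>n\<close> columns is, transposed, a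
  \<open>(q, p)\<close>-Sudoku rectangle with \<open>n\<close> rows, so filling the missing columns, transposing, and filling
  the missing columns again yields the square.

  To add columns to a rectangle of \<open>a\<close> row bands and \<open>b\<close> column stacks, consider the bipartite graph
  whose edges are the pairs of a row and a symbol missing from that row
  (\<open>sudoku_rectangle_extend_columns\<close>). Placing the new entries means giving each edge a column, and
  two edge colourings do this, the first choosing the stack and the second the column inside it.

  For the first, a symbol is replaced by one copy for each band. A row has
  \<open>(p - b) * q\<close> edges. In each band, a symbol lies in \<open>b\<close> of the \<open>p\<close> rows, since it occurs once in
  every big cell already present; so a pair of a band and a symbol has \<open>p - b\<close> edges. Koenig's theorem,
  applied after splitting every row into \<open>q\<close> vertices of degree at most \<open>p - b\<close>, colours the edges with
  the \<open>p - b\<close> new stacks such that a row receives at most \<open>q\<close> symbols in each stack and a symbol occurs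
  at most once in each new big cell.

  Inside a new stack, a row then has at most \<open>q\<close> edges, and a symbol at most one edge per band, hence at
  most \<open>a \<le> q\<close>. Koenig's theorem colours these edges with the \<open>q\<close> columns of the stack such that
  neither a row nor a symbol meets a column twice. As a row has as many missing symbols as there are new
  columns, every new cell gets filled.

  Koenig's theorem itself (\<open>konig_edge_colouring\<close>) follows by adding edges one at a time and swapping
  two colours along a Kempe chain.
\<close>

section \<open>Edge colourings of bipartite multigraphs\<close>

text \<open>
  A bipartite multigraph is a set of edges \<open>E\<close> with two maps \<open>f\<close> and \<open>g\<close> to the left and right ends.
  This form allows parallel edges and lets vertices be split or merged by changing a map alone.

  The chain is the path that leaves the left vertex \<open>v\<close> by its \<open>\<beta>\<close>-edge and alternates between \<open>\<beta>\<close> and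
  \<open>\<alpha>\<close>. The rules walk it in one direction: from left to right it always uses \<open>\<beta>\<close>, from right to left
  \<open>\<alpha>\<close>. Hence it cannot reach a right vertex that has no \<open>\<beta>\<close>-edge.
\<close>
inductive_set kempe_chain ::
    "'e set \<Rightarrow> ('e \<Rightarrow> 'a) \<Rightarrow> ('e \<Rightarrow> 'b) \<Rightarrow> ('e \<Rightarrow> nat) \<Rightarrow> nat \<Rightarrow> nat \<Rightarrow> 'a \<Rightarrow> 'e set"
  for E f g c \<alpha> \<beta> v where
  start: "e \<in> E \<Longrightarrow> f e = v \<Longrightarrow> c e = \<beta> \<Longrightarrow> e \<in> kempe_chain E f g c \<alpha> \<beta> v"
| right: "e \<in> kempe_chain E f g c \<alpha> \<beta> v \<Longrightarrow> c e = \<beta> \<Longrightarrow> e' \<in> E \<Longrightarrow> c e' = \<alpha> \<Longrightarrow> g e' = g e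
    \<Longrightarrow> e' \<in> kempe_chain E f g c \<alpha> \<beta> v"
| left: "e \<in> kempe_chain E f g c \<alpha> \<beta> v \<Longrightarrow> c e = \<alpha> \<Longrightarrow> e' \<in> E \<Longrightarrow> c e' = \<beta> \<Longrightarrow> f e' = f e
    \<Longrightarrow> e' \<in> kempe_chain E f g c \<alpha> \<beta> v"

definition proper_colouring ::
    "'e set \<Rightarrow> ('e \<Rightarrow> 'a) \<Rightarrow> ('e \<Rightarrow> 'b) \<Rightarrow> nat \<Rightarrow> ('e \<Rightarrow> nat) \<Rightarrow> bool" where
  "proper_colouring E f g d c \<longleftrightarrow>
     (\<forall>e\<in>E. c e < d) \<and> inj_on (\<lambda>e. (f e, c e)) E \<and> inj_on (\<lambda>e. (g e, c e)) E"

text \<open>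
  Swapping the two colours on the chain from \<open>v\<close> makes \<open>\<beta>\<close> free at \<open>v\<close>. The colouring stays proper
  because the chain contains, with an edge, every \<open>\<alpha>\<close>- or \<open>\<beta>\<close>-edge that meets it. The vertex \<open>w\<close> keeps
  \<open>\<beta>\<close> free because the chain never reaches it.
\<close>
lemma kempe_swap:
  assumes col: "proper_colouring E f g d c"
    and "\<alpha> \<noteq> \<beta>" "\<alpha> < d" "\<beta> < d"
    and no_\<alpha>: "\<And>e. e \<in> E \<Longrightarrow> f e = v \<Longrightarrow> c e \<noteq> \<alpha>"
    and no_\<beta>: "\<And>e. e \<in> E \<Longrightarrow> g e = w \<Longrightarrow> c e \<noteq> \<beta>"
  shows "\<exists>c'. proper_colouring E f g d c' \<and>
    (\<forall>e\<in>E. f e = v \<longrightarrow> c' e \<noteq> \<beta>) \<and> (\<forall>e\<in>E. g e = w \<longrightarrow> c' e \<noteq> \<beta>)"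
proof -
  define K where "K = kempe_chain E f g c \<alpha> \<beta> v"
  define c' where "c' e = (if e \<in> K then (if c e = \<alpha> then \<beta> else \<alpha>) else c e)" for e
  have inj_f: "e = e'" if "e \<in> E" "e' \<in> E" "f e = f e'" "c e = c e'" for e e'
    using col that unfolding proper_colouring_def inj_on_def by blast
  have inj_g: "e = e'" if "e \<in> E" "e' \<in> E" "g e = g e'" "c e = c e'" for e e'
    using col that unfolding proper_colouring_def inj_on_def by blast
  have K_E: "e \<in> E \<and> (c e = \<alpha> \<or> c e = \<beta>)" if "e \<in> K" for e
    using that unfolding K_def by (induction rule: kempe_chain.induct) auto
  have from_\<beta>: "\<exists>e'\<in>K. c e' = \<beta> \<and> g e' = g e" if "e \<in> K" "c e = \<alpha>" for e
    using that(1) unfolding K_def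
    by (cases rule: kempe_chain.cases) (use that \<open>\<alpha> \<noteq> \<beta>\<close> in auto)
  have from_\<alpha>: "f e = v \<or> (\<exists>e'\<in>K. c e' = \<alpha> \<and> f e' = f e)" if "e \<in> K" "c e = \<beta>" for e
    using that(1) unfolding K_def
    by (cases rule: kempe_chain.cases) (use that \<open>\<alpha> \<noteq> \<beta>\<close> in auto)
  \<comment> \<open>The rules close the chain only in the direction of travel. In the other direction, the edge in
    question is the one by which the chain arrived, as properness leaves no second candidate; at the
    start \<open>v\<close> there is no \<open>\<alpha>\<close>-edge at all.\<close>
  have closed_f: "e' \<in> K" if "e \<in> K" "e' \<in> E" "f e' = f e" and shared: "c e' = \<alpha> \<or> c e' = \<beta>" for e e'
  proof (cases "c e' = c e")
    case True
    then show ?thesis using inj_f that K_E by metis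
  next
    case False
    then consider "c e = \<alpha>" "c e' = \<beta>" | "c e = \<beta>" "c e' = \<alpha>"
      using K_E[OF \<open>e \<in> K\<close>] shared by auto
    then show ?thesis
    proof cases
      case 1
      then show ?thesis using that kempe_chain.left unfolding K_def by metis
    next
      case 2
      then have "f e \<noteq> v" using no_\<alpha> that by metis
      then obtain e'' where "e'' \<in> K" "c e'' = \<alpha>" "f e'' = f e"
        using from_\<alpha>[OF \<open>e \<in> K\<close>] 2 by blast
      then show ?thesis using inj_f[of e'' e'] that 2 K_E by auto
    qed
  qed
  have closed_g: "e' \<in> K" if "e \<in> K" "e' \<in> E" "g e' = g e" and shared: "c e' = \<alpha> \<or> c e' = \<beta>" for e e'
  proof (cases "c e' = c e")
    case True
    then show ?thesis using inj_g that K_E by metis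
  next
    case False
    then consider "c e = \<alpha>" "c e' = \<beta>" | "c e = \<beta>" "c e' = \<alpha>"
      using K_E[OF \<open>e \<in> K\<close>] shared by auto
    then show ?thesis
    proof cases
      case 1
      then obtain e'' where "e'' \<in> K" "c e'' = \<beta>" "g e'' = g e"
        using from_\<beta>[OF \<open>e \<in> K\<close>] 1 by blast
      then show ?thesis using inj_g[of e'' e'] that 1 K_E by auto
    next
      case 2
      then show ?thesis using that kempe_chain.right unfolding K_def by metis
    qed
  qed
  have same_colour: "c e = c e'" if "c' e = c' e'" "e \<in> K \<longleftrightarrow> e' \<in> K" for e e'
    using that K_E[of e] K_E[of e'] \<open>\<alpha> \<noteq> \<beta>\<close> unfolding c'_def by (auto split: if_splits)
  have shared_colour: "c e' = \<alpha> \<or> c e' = \<beta>" if "e \<in> K" "c' e = c' e'" for e e'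
    using that K_E[of e'] unfolding c'_def by (auto split: if_splits)
  have "e = e'" if "e \<in> E" "e' \<in> E" "f e = f e'" "c' e = c' e'" for e e'
  proof -
    have "e \<in> K \<longleftrightarrow> e' \<in> K" using closed_f shared_colour that by metis
    then show ?thesis using inj_f same_colour that by blast
  qed
  moreover have "e = e'" if "e \<in> E" "e' \<in> E" "g e = g e'" "c' e = c' e'" for e e'
  proof -
    have "e \<in> K \<longleftrightarrow> e' \<in> K" using closed_g shared_colour that by metis
    then show ?thesis using inj_g same_colour that by blast
  qed
  moreover have "c' e < d" if "e \<in> E" for e
    using that col assms(3,4) unfolding c'_def proper_colouring_def by auto
  ultimately have "proper_colouring E f g d c'"
    unfolding proper_colouring_def inj_on_def by simp
  moreover have "c' e \<noteq> \<beta>" if "e \<in> E" "f e = v" for e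
    using that no_\<alpha>[OF that] \<open>\<alpha> \<noteq> \<beta>\<close> kempe_chain.start[of e E f v c \<beta> g \<alpha>]
    unfolding c'_def K_def by auto
  moreover have "c' e \<noteq> \<beta>" if "e \<in> E" "g e = w" for e
    using no_\<beta>[OF that] from_\<beta>[of e] no_\<beta> K_E that \<open>\<alpha> \<noteq> \<beta>\<close>
    unfolding c'_def by (auto split: if_splits)
  ultimately show ?thesis by blast
qed

lemma free_colour:
  assumes "finite E" and "card {e \<in> insert e0 E. h e = h e0} \<le> d" and "e0 \<notin> E"
  shows "\<exists>\<alpha><d. \<forall>e\<in>E. h e = h e0 \<longrightarrow> c e \<noteq> \<alpha>"
proof -
  let ?F = "{e \<in> E. h e = h e0}"
  have "{e \<in> insert e0 E. h e = h e0} = insert e0 ?F" by auto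
  then have "card ?F < d" using assms by simp
  moreover have "card (c ` ?F) \<le> card ?F" using assms(1) by (intro card_image_le) simp
  ultimately have "card (c ` ?F) < card {..<d}" by simp
  moreover have "finite (c ` ?F)" using assms(1) by simp
  ultimately have "\<not> {..<d} \<subseteq> c ` ?F" using card_mono linorder_not_le by blast
  then show ?thesis by blast
qed

text \<open>
  A new edge needs a colour free at both ends. The degree bound leaves a colour \<open>\<alpha>\<close> free at the left end
  and a colour \<open>\<beta>\<close> free at the right end, and a Kempe swap makes \<open>\<beta>\<close> free at both.
\<close>
lemma konig_edge_colouring:
  fixes f :: "'e \<Rightarrow> 'a" and g :: "'e \<Rightarrow> 'b"
  assumes "finite E"
    and "\<And>a. card {e \<in> E. f e = a} \<le> d" and "\<And>b. card {e \<in> E. g e = b} \<le> d"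
  shows "\<exists>c. proper_colouring E f g d c"
  using assms
proof (induction E rule: finite_induct)
  case empty
  then show ?case by (simp add: proper_colouring_def)
next
  case (insert e0 E)
  have "card {e \<in> E. f e = a} \<le> d" for a
    using insert.prems(1)[of a] insert.hyps(1)
    by (intro order.trans[OF card_mono insert.prems(1)[of a]]) auto
  moreover have "card {e \<in> E. g e = b} \<le> d" for b
    using insert.hyps(1)
    by (intro order.trans[OF card_mono insert.prems(2)[of b]]) auto
  ultimately obtain c where c: "proper_colouring E f g d c" using insert.IH by blast
  obtain \<alpha> where \<alpha>: "\<alpha> < d" "\<And>e. e \<in> E \<Longrightarrow> f e = f e0 \<Longrightarrow> c e \<noteq> \<alpha>"
    using free_colour[OF insert.hyps(1) insert.prems(1) insert.hyps(2), of c] by blast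
  obtain \<beta> where \<beta>: "\<beta> < d" "\<And>e. e \<in> E \<Longrightarrow> g e = g e0 \<Longrightarrow> c e \<noteq> \<beta>"
    using free_colour[OF insert.hyps(1) insert.prems(2) insert.hyps(2), of c] by blast
  have "\<exists>c'. proper_colouring E f g d c' \<and>
      (\<forall>e\<in>E. f e = f e0 \<longrightarrow> c' e \<noteq> \<beta>) \<and> (\<forall>e\<in>E. g e = g e0 \<longrightarrow> c' e \<noteq> \<beta>)"
  proof (cases "\<alpha> = \<beta>")
    case True
    then show ?thesis using c \<alpha> \<beta> by blast
  next
    case False
    then show ?thesis using kempe_swap[OF c False \<alpha>(1) \<beta>(1)] \<alpha>(2) \<beta>(2) by blast
  qed
  then obtain c' where c': "proper_colouring E f g d c'"
    "\<And>e. e \<in> E \<Longrightarrow> f e = f e0 \<Longrightarrow> c' e \<noteq> \<beta>" "\<And>e. e \<in> E \<Longrightarrow> g e = g e0 \<Longrightarrow> c' e \<noteq> \<beta>"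
    by blast
  have "proper_colouring (insert e0 E) f g d (c'(e0 := \<beta>))"
    using c' \<beta>(1) insert.hyps(2) unfolding proper_colouring_def inj_on_def
    by (auto split: if_splits) metis+
  then show ?case by blast
qed

text \<open>
  Numbering the edges at a left vertex and cutting the numbers into runs of length \<open>d\<close> splits the vertex
  into at most \<open>m\<close> vertices of degree at most \<open>d\<close>. In a proper colouring of the split graph each of these
  meets a colour at most once.
\<close>
lemma konig_edge_colouring_capacity:
  fixes f :: "'e \<Rightarrow> 'a" and g :: "'e \<Rightarrow> 'b"
  assumes fin: "finite E"
    and deg_f: "\<And>a. card {e \<in> E. f e = a} \<le> m * d" and deg_g: "\<And>b. card {e \<in> E. g e = b} \<le> d"
  shows "\<exists>c. (\<forall>e\<in>E. c e < d) \<and> (\<forall>a k. card {e \<in> E. f e = a \<and> c e = k} \<le> m) \<and>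
    inj_on (\<lambda>e. (g e, c e)) E"
proof -
  have "\<exists>h. bij_betw h {e \<in> E. f e = a} {0..<card {e \<in> E. f e = a}}" for a
    using fin by (intro ex_bij_betw_finite_nat) simp
  then obtain h where h: "\<And>a. bij_betw (h a) {e \<in> E. f e = a} {0..<card {e \<in> E. f e = a}}"
    by metis
  define part where "part e = h (f e) e div d" for e
  have inj_h: "inj_on (h a) {e \<in> E. f e = a}" for a
    using h by (blast dest: bij_betw_imp_inj_on)
  have h_less: "h (f e) e < m * d" if "e \<in> E" for e
  proof -
    have "h (f e) e \<in> {0..<card {e' \<in> E. f e' = f e}}"
      using h[of "f e"] that by (auto dest: bij_betwE)
    then show ?thesis using deg_f[of "f e"] by simp
  qed
  have deg_part: "card {e \<in> E. (f e, part e) = z} \<le> d" for z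
  proof -
    obtain a j where z: "z = (a, j)" by (cases z)
    have "h a e \<in> {j * d..<j * d + d}" if "e \<in> E" "f e = a" "part e = j" for e
    proof -
      have "0 < d" using h_less[OF that(1)] by (cases d) auto
      then show ?thesis
        using that div_times_less_eq_dividend[of "h a e" d] dividend_less_div_times[of d "h a e"]
        unfolding part_def by auto
    qed
    then have "card {e \<in> E. (f e, part e) = z} \<le> card {j * d..<j * d + d}"
      using inj_h[of a] z by (intro card_inj_on_le[where f = "h a"]) (auto simp: inj_on_def)
    then show ?thesis by simp
  qed
  obtain c where c: "proper_colouring E (\<lambda>e. (f e, part e)) g d c"
    using konig_edge_colouring[OF fin, of "\<lambda>e. (f e, part e)" d g] deg_part deg_g by blast
  have "card {e \<in> E. f e = a \<and> c e = k} \<le> m" for a k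
  proof -
    have "part e < m" if "e \<in> E" for e
      using h_less[OF that] unfolding part_def by (simp add: less_mult_imp_div_less)
    then have "card {e \<in> E. f e = a \<and> c e = k} \<le> card {..<m}"
      using c by (intro card_inj_on_le[where f = part]) (auto simp: proper_colouring_def inj_on_def)
    then show ?thesis by simp
  qed
  then show ?thesis using c unfolding proper_colouring_def by blast
qed

section \<open>Sudoku rectangles cell by cell\<close>

text \<open>
  The band or stack of an index, counted from 0 although indices are counted from 1; this matches the
  numbering of the big cells.
\<close>
definition block :: "nat \<Rightarrow> nat \<Rightarrow> nat" where
  "block p i = (i - 1) div p"

lemma block_eq_iff:
  assumes "1 \<le> p" "1 \<le> i"
  shows "block p i = x \<longleftrightarrow> (\<exists>t\<in>{1..p}. i = x * p + t)"
proof
  assume "block p i = x"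
  then have "i = x * p + ((i - 1) mod p + 1)"
    using div_mult_mod_eq[of "i - 1" p] assms unfolding block_def by simp
  moreover have "(i - 1) mod p + 1 \<in> {1..p}"
    using assms mod_less_divisor[of p "i - 1"] by (simp add: Suc_le_eq)
  ultimately show "\<exists>t\<in>{1..p}. i = x * p + t" by blast
next
  assume "\<exists>t\<in>{1..p}. i = x * p + t"
  then obtain t where "t \<in> {1..p}" "i = x * p + t" by blast
  then have "i - 1 = x * p + (t - 1)" "t - 1 < p" by auto
  then show "block p i = x" unfolding block_def by simp
qed

lemma block_less:
  assumes "1 \<le> p" "i \<in> {1..m * p}"
  shows "block p i < m"
  using assms unfolding block_def by (auto intro!: less_mult_imp_div_less)

lemma big_cell_eq:
  assumes "1 \<le> p" "1 \<le> q"
  shows "big_cell p q x y = {(i, j). 1 \<le> i \<and> 1 \<le> j \<and> block p i = x \<and> block q j = y}"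
  using block_eq_iff[OF assms(1), of _ x] block_eq_iff[OF assms(2), of _ y]
  unfolding big_cell_def by fastforce

lemma card_big_cell: "card (big_cell p q x y) = p * q"
proof -
  have "big_cell p q x y = (\<lambda>(i, j). (x * p + i, y * q + j)) ` ({1..p} \<times> {1..q})"
    unfolding big_cell_def by auto
  moreover have "inj_on (\<lambda>(i, j). (x * p + i, y * q + j)) ({1..p} \<times> {1..q})"
    by (auto simp: inj_on_def)
  ultimately show ?thesis by (simp add: card_image)
qed

text \<open>
  With rows, columns and big cells treated alike as ways for two cells to clash, the condition is visibly
  symmetric under transposition and can be checked for a pair of cells at a time.
\<close>
lemma sudoku_rectangle_iff:
  assumes "1 \<le> p" "1 \<le> q" "r \<le> p * q" "s \<le> p * q"
  shows "sudoku_rectangle p q r s R \<longleftrightarrow>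
    (\<forall>i\<in>{1..r}. \<forall>j\<in>{1..s}. R i j \<in> {1..p * q}) \<and>
    (\<forall>i\<in>{1..r}. \<forall>j\<in>{1..s}. \<forall>i'\<in>{1..r}. \<forall>j'\<in>{1..s}.
      R i j = R i' j' \<and> (i = i' \<or> j = j' \<or> block p i = block p i' \<and> block q j = block q j')
      \<longrightarrow> i = i' \<and> j = j')"
    (is "_ \<longleftrightarrow> ?range \<and> ?inj")
proof -
  have cells: "(\<forall>x<q. \<forall>y<p. inj_on (\<lambda>c. R (fst c) (snd c)) (big_cell p q x y \<inter> {1..r} \<times> {1..s}))
    \<longleftrightarrow> (\<forall>i\<in>{1..r}. \<forall>j\<in>{1..s}. \<forall>i'\<in>{1..r}. \<forall>j'\<in>{1..s}.
      R i j = R i' j' \<and> block p i = block p i' \<and> block q j = block q j' \<longrightarrow> i = i' \<and> j = j')"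
    (is "?L \<longleftrightarrow> ?R")
  proof
    assume L: ?L
    show ?R
    proof (intro ballI impI)
      fix i j i' j'
      assume *: "i \<in> {1..r}" "j \<in> {1..s}" "i' \<in> {1..r}" "j' \<in> {1..s}"
        and **: "R i j = R i' j' \<and> block p i = block p i' \<and> block q j = block q j'"
      have "block p i < q" "block q j < p"
        using * assms by (auto intro!: block_less simp: mult.commute)
      then have "inj_on (\<lambda>c. R (fst c) (snd c))
          (big_cell p q (block p i) (block q j) \<inter> {1..r} \<times> {1..s})" using L by blast
      then have "(i, j) = (i', j')"
        by (rule inj_onD) (use * ** in \<open>auto simp: big_cell_eq[OF assms(1,2)]\<close>)
      then show "i = i' \<and> j = j'" by simp
    qed
  next
    assume R: ?R
    show ?L
    proof (intro allI impI inj_onI)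
      fix x y c c'
      assume "c \<in> big_cell p q x y \<inter> {1..r} \<times> {1..s}" "c' \<in> big_cell p q x y \<inter> {1..r} \<times> {1..s}"
        "R (fst c) (snd c) = R (fst c') (snd c')"
      then have "fst c = fst c' \<and> snd c = snd c'"
        unfolding big_cell_eq[OF assms(1,2)]
        by (intro R[rule_format]) auto
      then show "c = c'" by (simp add: prod_eq_iff)
    qed
  qed
  show ?thesis
  proof
    assume R: "sudoku_rectangle p q r s R"
    then have latin: "latin_rectangle r s (p * q) R"
      unfolding sudoku_rectangle_def by (elim conjE)
    have cell: "\<forall>i\<in>{1..r}. \<forall>j\<in>{1..s}. \<forall>i'\<in>{1..r}. \<forall>j'\<in>{1..s}.
        R i j = R i' j' \<and> block p i = block p i' \<and> block q j = block q j' \<longrightarrow> i = i' \<and> j = j'"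
      using R unfolding sudoku_rectangle_def cells by (elim conjE)
    have row: "j = j'" if "i \<in> {1..r}" "j \<in> {1..s}" "j' \<in> {1..s}" "R i j = R i j'" for i j j'
      using latin that unfolding latin_rectangle_def inj_on_def by blast
    have column: "i = i'" if "j \<in> {1..s}" "i \<in> {1..r}" "i' \<in> {1..r}" "R i j = R i' j" for j i i'
      using latin that unfolding latin_rectangle_def inj_on_def by blast
    have ?range using latin unfolding latin_rectangle_def by simp
    moreover have ?inj
    proof (intro ballI impI)
      fix i j i' j'
      assume "i \<in> {1..r}" "j \<in> {1..s}" "i' \<in> {1..r}" "j' \<in> {1..s}"
        and "R i j = R i' j' \<and> (i = i' \<or> j = j' \<or> block p i = block p i' \<and> block q j = block q j')"
      then show "i = i' \<and> j = j'" using row column cell by metis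
    qed
    ultimately show "?range \<and> ?inj" by (rule conjI)
  next
    assume *: "?range \<and> ?inj"
    show "sudoku_rectangle p q r s R"
      unfolding sudoku_rectangle_def latin_rectangle_def cells
    proof (intro conjI)
      show ?range using * by (rule conjunct1)
      show "\<forall>i\<in>{1..r}. inj_on (\<lambda>j. R i j) {1..s}"
        unfolding inj_on_def using * by metis
      show "\<forall>j\<in>{1..s}. inj_on (\<lambda>i. R i j) {1..r}"
        unfolding inj_on_def using * by metis
      show "\<forall>i\<in>{1..r}. \<forall>j\<in>{1..s}. \<forall>i'\<in>{1..r}. \<forall>j'\<in>{1..s}.
        R i j = R i' j' \<and> block p i = block p i' \<and> block q j = block q j' \<longrightarrow> i = i' \<and> j = j'"
        using * by metis
    qed (use assms in simp_all)
  qed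
qed

lemma sudoku_rectangle_transpose:
  assumes "1 \<le> p" "1 \<le> q" "r \<le> p * q" "s \<le> p * q" and R: "sudoku_rectangle p q r s R"
  shows "sudoku_rectangle q p s r (\<lambda>i j. R j i)"
proof -
  have le: "s \<le> q * p" "r \<le> q * p" using assms(3,4) by (simp_all add: mult.commute)
  note R' = R[unfolded sudoku_rectangle_iff[OF assms(1-4)]]
  show ?thesis
    unfolding sudoku_rectangle_iff[OF assms(2,1) le]
  proof (intro conjI[OF _ ballI[OF ballI[OF ballI[OF ballI[OF impI]]]]] ballI)
    fix i j assume "i \<in> {1..s}" "j \<in> {1..r}"
    then show "R j i \<in> {1..q * p}"
      using R'[THEN conjunct1, rule_format, of j i] by (simp only: mult.commute[of q p])
  next
    fix i j i' j'
    assume "i \<in> {1..s}" "j \<in> {1..r}" "i' \<in> {1..s}" "j' \<in> {1..r}"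
      and "R j i = R j' i' \<and> (i = i' \<or> j = j' \<or> block q i = block q i' \<and> block p j = block p j')"
    then show "i = i' \<and> j = j'" using R' by metis
  qed
qed

lemma bijection_unique_preimage:
  assumes "finite B" "inj_on f A" "f ` A \<subseteq> B" "card A = card B" "k \<in> B"
  shows "\<exists>!x. x \<in> A \<and> f x = k"
proof -
  have "f ` A = B" using assms by (intro card_subset_eq) (auto simp: card_image)
  then show ?thesis using assms(2,5) by (auto simp: inj_on_def)
qed

lemma big_cell_subset:
  assumes "x < a" "y < b"
  shows "big_cell p q x y \<subseteq> {1..a * p} \<times> {1..b * q}"
proof
  fix c assume "c \<in> big_cell p q x y"
  then obtain i j where c: "c = (x * p + i, y * q + j)" "i \<in> {1..p}" "j \<in> {1..q}"
    unfolding big_cell_def by blast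
  have "(x + 1) * p \<le> a * p" "(y + 1) * q \<le> b * q"
    using assms by (intro mult_right_mono; simp)+
  then show "c \<in> {1..a * p} \<times> {1..b * q}" using c by auto
qed

lemma full_cell_unique:
  assumes "sudoku_rectangle p q (a * p) (b * q) R" "x < a" "y < b" "a \<le> q" "b \<le> p"
    and "k \<in> {1..p * q}"
  shows "\<exists>!c. c \<in> big_cell p q x y \<and> R (fst c) (snd c) = k"
proof (rule bijection_unique_preimage)
  have sub: "big_cell p q x y \<subseteq> {1..a * p} \<times> {1..b * q}"
    using assms by (intro big_cell_subset)
  moreover have "x < q" "y < p" using assms by auto
  ultimately show "inj_on (\<lambda>c. R (fst c) (snd c)) (big_cell p q x y)"
    using assms(1) unfolding sudoku_rectangle_def by (metis (no_types, lifting) inf.absorb1)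
  show "(\<lambda>c. R (fst c) (snd c)) ` big_cell p q x y \<subseteq> {1..p * q}"
    using sub assms(1) unfolding sudoku_rectangle_def latin_rectangle_def by fastforce
qed (use assms in \<open>simp_all add: card_big_cell\<close>)

lemma sudoku_square_if_rectangle:
  assumes "sudoku_rectangle p q (p * q) (p * q) R"
  shows "sudoku_square p q R"
proof -
  have lat: "latin_rectangle (p * q) (p * q) (p * q) R"
    using assms unfolding sudoku_rectangle_def by blast
  have entry: "R i j \<in> {1..p * q}" if "i \<in> {1..p * q}" "j \<in> {1..p * q}" for i j
    using lat that unfolding latin_rectangle_def by blast
  have row: "\<exists>!j. j \<in> {1..p * q} \<and> R i j = k" if "i \<in> {1..p * q}" "k \<in> {1..p * q}" for i k
    using lat entry that unfolding latin_rectangle_def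
    by (intro bijection_unique_preimage[of "{1..p * q}"]) blast+
  have column: "\<exists>!i. i \<in> {1..p * q} \<and> R i j = k" if "j \<in> {1..p * q}" "k \<in> {1..p * q}" for j k
    using lat entry that unfolding latin_rectangle_def
    by (intro bijection_unique_preimage[of "{1..p * q}"]) blast+
  have cell: "\<exists>!c. c \<in> big_cell p q x y \<and> R (fst c) (snd c) = k"
    if "x < q" "y < p" "k \<in> {1..p * q}" for x y k
    using that assms full_cell_unique[of p q q p R x y k] by (simp only: mult.commute[of q p] order.refl)
  show ?thesis
    unfolding sudoku_square_def latin_square_def
    by (intro conjI ballI allI impI entry row column cell)
qed

section \<open>Filling the missing columns\<close>

text \<open>
  The symbol occurs once in each of the \<open>b\<close> full big cells of the band, and these occurrences lie in
  different rows because no row repeats a symbol. So at most \<open>p - b\<close> of the \<open>p\<close> rows lack it.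
\<close>
lemma card_band_rows_missing_symbol:
  assumes R: "sudoku_rectangle p q (a * p) (b * q) R"
    and "1 \<le> p" "1 \<le> q" "a \<le> q" "b \<le> p" "x < a" "k \<in> {1..p * q}"
  shows "card {i \<in> {1..a * p}. block p i = x \<and> k \<notin> R i ` {1..b * q}} \<le> p - b"
proof -
  define I where "I = {x * p + 1..x * p + p}"
  define P where "P = {i \<in> I. k \<in> R i ` {1..b * q}}"
  have "\<exists>c. c \<in> big_cell p q x y \<and> R (fst c) (snd c) = k" if "y < b" for y
    using full_cell_unique[OF R \<open>x < a\<close> that assms(4,5,7)] by blast
  then obtain c where c: "\<And>y. y < b \<Longrightarrow> c y \<in> big_cell p q x y"
    "\<And>y. y < b \<Longrightarrow> R (fst (c y)) (snd (c y)) = k" by metis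
  have c_in: "c y \<in> {1..a * p} \<times> {1..b * q}" if "y < b" for y
    using c(1)[OF that] big_cell_subset[OF \<open>x < a\<close> that] by blast
  have "inj_on (\<lambda>y. fst (c y)) {..<b}"
  proof (rule inj_onI)
    fix y y' assume y: "y \<in> {..<b}" "y' \<in> {..<b}" and eq: "fst (c y) = fst (c y')"
    have "inj_on (R (fst (c y))) {1..b * q}"
      using R c_in[of y] y unfolding sudoku_rectangle_def latin_rectangle_def by auto
    then have "snd (c y) = snd (c y')"
      by (rule inj_onD) (use c(2) c_in y eq in \<open>fastforce+\<close>)
    then show "y = y'" using c(1)[of y] c(1)[of y'] y
      by (auto simp: big_cell_eq[OF assms(2,3)])
  qed
  moreover have "fst (c y) \<in> P" if "y < b" for y
  proof -
    have "fst (c y) \<in> I" using c(1)[OF that] unfolding I_def big_cell_def by auto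
    moreover have "k \<in> R (fst (c y)) ` {1..b * q}"
      using c(2)[OF that] c_in[OF that] by (metis imageI mem_Times_iff)
    ultimately show ?thesis unfolding P_def by blast
  qed
  ultimately have "card {..<b} \<le> card P"
    by (intro card_inj_on_le[where f = "\<lambda>y. fst (c y)"]) (auto simp: P_def I_def)
  moreover have "card (I - P) = card I - card P"
    by (intro card_Diff_subset) (auto simp: P_def I_def)
  moreover have "i \<in> I" if "1 \<le> i" "block p i = x" for i
    using block_eq_iff[OF \<open>1 \<le> p\<close> that(1), of x] that(2) unfolding I_def by auto
  then have "{i \<in> {1..a * p}. block p i = x \<and> k \<notin> R i ` {1..b * q}} \<subseteq> I - P"
    unfolding P_def by auto
  then have "card {i \<in> {1..a * p}. block p i = x \<and> k \<notin> R i ` {1..b * q}} \<le> card (I - P)"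
    by (intro card_mono) (auto simp: I_def)
  ultimately show ?thesis by (simp add: I_def)
qed

text \<open>
  The first colouring assigns each pair of a row and a missing symbol to a new stack \<open>b + stack e\<close>, the
  second to a position \<open>pos e\<close> in that stack. The three injectivity facts \<open>row\<close>, \<open>symbol\<close> and \<open>cell\<close> say in
  turn that a cell receives only one symbol, that no column repeats a symbol, and that no big cell does.
\<close>
lemma sudoku_rectangle_extend_columns:
  assumes R: "sudoku_rectangle p q (a * p) (b * q) R"
    and pq: "1 \<le> p" "1 \<le> q" and "a \<le> q" "b \<le> p"
  shows "\<exists>S. sudoku_rectangle p q (a * p) (p * q) S \<and>
    (\<forall>i\<in>{1..a * p}. \<forall>j\<in>{1..b * q}. S i j = R i j)"
proof -
  let ?r = "a * p" and ?s = "b * q" and ?n = "p * q"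
  have le: "?r \<le> ?n" "?s \<le> ?n" using R unfolding sudoku_rectangle_def by auto
  note R_iff = R[unfolded sudoku_rectangle_iff[OF pq le]]
  note R_range = R_iff[THEN conjunct1, rule_format]
  note R_inj = R_iff[THEN conjunct2, rule_format]
  define E where "E = {(i, k). i \<in> {1..?r} \<and> k \<in> {1..?n} \<and> k \<notin> R i ` {1..?s}}"
  have "E \<subseteq> {1..?r} \<times> {1..?n}" unfolding E_def by auto
  then have fin: "finite E" by (rule finite_subset) simp
  have missing: "card {k \<in> {1..?n}. k \<notin> R i ` {1..?s}} = ?n - ?s" if "i \<in> {1..?r}" for i
  proof -
    have "inj_on (R i) {1..?s}" "R i ` {1..?s} \<subseteq> {1..?n}"
      using R that unfolding sudoku_rectangle_def latin_rectangle_def by auto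
    then have "card ({1..?n} - R i ` {1..?s}) = ?n - ?s"
      by (subst card_Diff_subset) (simp_all add: card_image)
    moreover have "{k \<in> {1..?n}. k \<notin> R i ` {1..?s}} = {1..?n} - R i ` {1..?s}" by auto
    ultimately show ?thesis by simp
  qed
  have row_deg: "card {e \<in> E. fst e = i} \<le> q * (p - b)" for i
  proof (cases "i \<in> {1..?r}")
    case True
    have "{e \<in> E. fst e = i} = Pair i ` {k \<in> {1..?n}. k \<notin> R i ` {1..?s}}"
      using True unfolding E_def by auto
    then have "card {e \<in> E. fst e = i} = ?n - ?s"
      using missing[OF True] by (simp add: card_image inj_on_def)
    then show ?thesis by (simp add: diff_mult_distrib2 mult.commute)
  next
    case False
    then have "{e \<in> E. fst e = i} = {}" unfolding E_def by auto
    then show ?thesis by (metis card.empty le0)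
  qed
  have symbol_deg: "card {e \<in> E. (block p (fst e), snd e) = z} \<le> p - b" for z
  proof -
    obtain x k where z: "z = (x, k)" by (cases z)
    let ?I = "{i \<in> {1..?r}. block p i = x \<and> k \<notin> R i ` {1..?s}}"
    show ?thesis
    proof (cases "x < a \<and> k \<in> {1..?n}")
      case True
      have "{e \<in> E. (block p (fst e), snd e) = z} = (\<lambda>i. (i, k)) ` ?I"
        using True z unfolding E_def by auto
      then have "card {e \<in> E. (block p (fst e), snd e) = z} = card ?I"
        by (simp add: card_image inj_on_def)
      then show ?thesis
        using card_band_rows_missing_symbol[OF R pq assms(4,5)] True by simp
    next
      case False
      then have "{e \<in> E. (block p (fst e), snd e) = z} = {}"
        using z block_less[OF pq(1), of _ a] unfolding E_def by auto
      then show ?thesis by (metis card.empty le0)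
    qed
  qed
  \<comment> \<open>Right ends are pairs of a band and a symbol, so that colour classes respect big cells.\<close>
  obtain stack where stack: "\<And>e. e \<in> E \<Longrightarrow> stack e < p - b"
    "\<And>i y. card {e \<in> E. fst e = i \<and> stack e = y} \<le> q"
    and cell: "inj_on (\<lambda>e. ((block p (fst e), snd e), stack e)) E"
    using konig_edge_colouring_capacity[OF fin row_deg symbol_deg] by blast
  have row_deg': "card {e \<in> E. (fst e, stack e) = z} \<le> q" for z
    using stack(2)[of "fst z" "snd z"] by (simp add: prod_eq_iff)
  \<comment> \<open>Edges with a common symbol and stack lie in different bands, of which there are \<open>a \<le> q\<close>.\<close>
  have symbol_deg': "card {e \<in> E. (snd e, stack e) = z} \<le> q" for z
  proof -
    have "card {e \<in> E. (snd e, stack e) = z} \<le> card {..<a}"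
    proof (rule card_inj_on_le[where f = "\<lambda>e. block p (fst e)"])
      show "inj_on (\<lambda>e. block p (fst e)) {e \<in> E. (snd e, stack e) = z}"
      proof (rule inj_onI)
        fix e e'
        assume "e \<in> {e \<in> E. (snd e, stack e) = z}" "e' \<in> {e \<in> E. (snd e, stack e) = z}"
          and "block p (fst e) = block p (fst e')"
        then show "e = e'" by (intro inj_onD[OF cell]) auto
      qed
      show "(\<lambda>e. block p (fst e)) ` {e \<in> E. (snd e, stack e) = z} \<subseteq> {..<a}"
        using block_less[OF pq(1), of _ a] unfolding E_def by auto
    qed simp
    then show ?thesis using \<open>a \<le> q\<close> by simp
  qed
  obtain pos where "proper_colouring E (\<lambda>e. (fst e, stack e)) (\<lambda>e. (snd e, stack e)) q pos"
    using konig_edge_colouring[OF fin row_deg' symbol_deg'] by blast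
  then have pos: "\<And>e. e \<in> E \<Longrightarrow> pos e < q"
    and row: "inj_on (\<lambda>e. ((fst e, stack e), pos e)) E"
    and symbol: "inj_on (\<lambda>e. ((snd e, stack e), pos e)) E"
    unfolding proper_colouring_def by auto
  define col where "col e = (b + stack e) * q + pos e + 1" for e
  have col_block: "block q (col e) = b + stack e" if "e \<in> E" for e
    using pos[OF that] unfolding col_def block_def by simp
  have col_eq: "stack e = stack e' \<and> pos e = pos e'" if "e \<in> E" "e' \<in> E" "col e = col e'" for e e'
  proof -
    have "stack e = stack e'" using col_block[OF that(1)] col_block[OF that(2)] that(3) by simp
    then show ?thesis using that(3) unfolding col_def by simp
  qed
  have col_range: "col e \<in> {?s + 1..?n}" if "e \<in> E" for e
  proof -
    have "(b + stack e + 1) * q \<le> p * q"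
      using stack(1)[OF that] by (intro mult_right_mono) auto
    then show ?thesis using pos[OF that] unfolding col_def by (auto simp: algebra_simps)
  qed
  have "\<exists>!k. k \<in> {k \<in> {1..?n}. k \<notin> R i ` {1..?s}} \<and> col (i, k) = j"
    if "i \<in> {1..?r}" "j \<in> {?s + 1..?n}" for i j
  proof (rule bijection_unique_preimage)
    show "inj_on (\<lambda>k. col (i, k)) {k \<in> {1..?n}. k \<notin> R i ` {1..?s}}"
    proof (rule inj_onI)
      fix k k' assume k: "k \<in> {k \<in> {1..?n}. k \<notin> R i ` {1..?s}}"
        "k' \<in> {k \<in> {1..?n}. k \<notin> R i ` {1..?s}}" "col (i, k) = col (i, k')"
      then have "(i, k) \<in> E" "(i, k') \<in> E" using that unfolding E_def by auto
      then have "(i, k) = (i, k')"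
        using col_eq[of "(i, k)" "(i, k')"] k(3) by (intro inj_onD[OF row]) auto
      then show "k = k'" by simp
    qed
    show "(\<lambda>k. col (i, k)) ` {k \<in> {1..?n}. k \<notin> R i ` {1..?s}} \<subseteq> {?s + 1..?n}"
      using col_range that unfolding E_def by blast
  qed (use that missing[OF that(1)] in auto)
  then have T_ex: "\<exists>k. (i, k) \<in> E \<and> col (i, k) = j" if "i \<in> {1..?r}" "j \<in> {?s + 1..?n}" for i j
    using that unfolding E_def by blast
  define T where "T i j = (SOME k. (i, k) \<in> E \<and> col (i, k) = j)" for i j
  have T: "(i, T i j) \<in> E" "col (i, T i j) = j" if "i \<in> {1..?r}" "j \<in> {?s + 1..?n}" for i j
    using someI_ex[OF T_ex[OF that]] unfolding T_def by blast+
  define S where "S i j = (if j \<le> ?s then R i j else T i j)" for i j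
  have "sudoku_rectangle p q ?r ?n S"
    unfolding sudoku_rectangle_iff[OF pq le(1) order.refl]
  proof (intro conjI ballI impI)
    fix i j assume ij: "i \<in> {1..?r}" "j \<in> {1..?n}"
    show "S i j \<in> {1..?n}"
    proof (cases "j \<le> ?s")
      case True
      then show ?thesis using R_range[of i j] ij unfolding S_def by simp
    next
      case False
      then show ?thesis using T(1)[of i j] ij unfolding S_def E_def by auto
    qed
  next
    fix i j i' j'
    assume ij: "i \<in> {1..?r}" "j \<in> {1..?n}" and ij': "i' \<in> {1..?r}" "j' \<in> {1..?n}"
      and *: "S i j = S i' j' \<and> (i = i' \<or> j = j' \<or> block p i = block p i' \<and> block q j = block q j')"
    \<comment> \<open>An old and a new cell never share a column or a big cell, and the symbols placed in a row were
      missing from its old part.\<close>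
    have old_new: False
      if "i \<in> {1..?r}" "j \<in> {1..?s}" "i' \<in> {1..?r}" "j' \<in> {?s + 1..?n}" "R i j = T i' j'"
        "i = i' \<or> j = j' \<or> block p i = block p i' \<and> block q j = block q j'" for i j i' j'
    proof -
      have "block q j < b" using that(2) pq by (intro block_less)
      moreover have "b \<le> block q j'" using col_block T[OF that(3,4)] by (metis le_add1)
      ultimately have "i = i'" using that by auto
      moreover have "T i' j' \<notin> R i' ` {1..?s}" using T(1)[OF that(3,4)] unfolding E_def by auto
      ultimately show False using that by (metis imageI)
    qed
    consider "j \<le> ?s" "j' \<le> ?s" | "j \<le> ?s" "\<not> j' \<le> ?s" | "\<not> j \<le> ?s" "j' \<le> ?s"
      | "\<not> j \<le> ?s" "\<not> j' \<le> ?s" by blast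
    then have "i = i' \<and> j = j'"
    proof cases
      case 1
      then show ?thesis using ij ij' * unfolding S_def by (intro R_inj) simp_all
    next
      case 2
      then show ?thesis using old_new[of i j i' j'] ij ij' * unfolding S_def by auto
    next
      case 3
      then show ?thesis using old_new[of i' j' i j] ij ij' * unfolding S_def by auto
    next
      case 4
      let ?e = "(i, T i j)" and ?e' = "(i', T i' j')"
      have j: "j \<in> {?s + 1..?n}" "j' \<in> {?s + 1..?n}" using 4 ij ij' by auto
      note e = T[OF ij(1) j(1)] and e' = T[OF ij'(1) j(2)]
      have k: "T i j = T i' j'" using * 4 unfolding S_def by simp
      from * consider "i = i'" | "j = j'" | "block p i = block p i'" "block q j = block q j'" by blast
      then have "?e = ?e'"
      proof cases
        case 1
        then show ?thesis using k by simp
      next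
        case 2
        then have "col ?e = col ?e'" using e(2) e'(2) by simp
        then have "stack ?e = stack ?e' \<and> pos ?e = pos ?e'" by (rule col_eq[OF e(1) e'(1)])
        then show ?thesis using k by (intro inj_onD[OF symbol _ e(1) e'(1)]) simp
      next
        case 3
        then have "stack ?e = stack ?e'"
          using col_block[OF e(1)] col_block[OF e'(1)] e(2) e'(2) by simp
        then show ?thesis using k 3 by (intro inj_onD[OF cell _ e(1) e'(1)]) simp
      qed
      then show ?thesis using e(2) e'(2) by (metis prod.inject)
    qed
    then show "i = i'" "j = j'" by auto
  qed
  moreover have "\<forall>i\<in>{1..?r}. \<forall>j\<in>{1..?s}. S i j = R i j" unfolding S_def by simp
  ultimately show ?thesis by blast
qed

theorem theorem2:
  fixes p q n r s :: nat and R :: "nat \<Rightarrow> nat \<Rightarrow> nat"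
  assumes "p \<ge> 1" and "q \<ge> 1" and "n = p * q"
    and "1 \<le> r" and "r \<le> n" and "1 \<le> s" and "s \<le> n"
    and "p dvd r" and "q dvd s"
    and "sudoku_rectangle p q r s R"
  shows "\<exists>S. sudoku_square p q S \<and> (\<forall>i\<in>{1..r}. \<forall>j\<in>{1..s}. S i j = R i j)"
proof -
  obtain a b where ab: "r = a * p" "s = b * q"
    using assms(8,9) by (metis dvd_def mult.commute)
  have le: "a * p \<le> p * q" "b * q \<le> p * q" using assms(3,5,7) ab by simp_all
  then have "a \<le> q" "b \<le> p" using assms(1,2) by (auto simp: mult.commute)
  then obtain S where S: "sudoku_rectangle p q (a * p) (p * q) S"
    "\<forall>i\<in>{1..r}. \<forall>j\<in>{1..s}. S i j = R i j"
    using sudoku_rectangle_extend_columns[of p q a b R] assms(1,2,10) ab by blast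
  have "sudoku_rectangle q p (p * q) (a * p) (\<lambda>i j. S j i)"
    using sudoku_rectangle_transpose[OF assms(1,2) le(1) order.refl S(1)] .
  then obtain T where T: "sudoku_rectangle q p (p * q) (q * p) T"
    "\<forall>i\<in>{1..p * q}. \<forall>j\<in>{1..a * p}. T i j = S j i"
    using sudoku_rectangle_extend_columns[of q p p a "\<lambda>i j. S j i"] assms(1,2) \<open>a \<le> q\<close> by blast
  have "sudoku_rectangle p q (p * q) (p * q) (\<lambda>i j. T j i)"
    using sudoku_rectangle_transpose[of q p "p * q" "q * p" T] T(1) assms(1,2)
    by (simp add: mult.commute)
  then have "sudoku_square p q (\<lambda>i j. T j i)" by (rule sudoku_square_if_rectangle)
  moreover have "T j i = R i j" if "i \<in> {1..r}" "j \<in> {1..s}" for i j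
  proof -
    have "i \<in> {1..a * p}" "j \<in> {1..p * q}"
      using that le(2) unfolding ab atLeastAtMost_iff by linarith+
    then show ?thesis using S(2) T(2) that by metis
  qed
  ultimately show ?thesis by blast
qed

end
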